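(* Let $\mathbb{M}$ be a set of stochastic kernels from $\mathbb{X}\times\mathbb{U}$ to $\mathbb{X}$. Suppose there is a probability measure $\psi$ on $\mathbb{X}$ such that every $M\in\mathbb{M}$ admits densities with respect to $\psi$, i.e. $M(dy|x,u)=f^{M}_{x,u}(y)\,\psi(dy)$ for all $(x,u)$, and that these densities are equicontinuous over $(x,u)$ uniformly over $y$: for every $(x,u)\in\mathbb{X}\times\mathbb{U}$ and $\epsilon>0$ there is $\delta>0$ such that $d((x,u),(x',u'))<\delta$ implies $|f^{M}_{x,u}(y)-f^{M}_{x',u'}(y)|\le\epsilon$ for all $y\in\mathbb{X}$ and all $M\in\mathbb{M}$. Let $\{\mathcal{T}_n\}_{n\in\mathbb{N}}\subseteq\mathbb{M}$ and $\mathcal{T}\in\mathbb{M}$. If $\mathcal{T}_n\to\mathcal{T}$ pointwise weakly, then $\mathcal{T}_n\to\mathcal{T}$ weakly continuously.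
   Context: $\mathbb{X}$ and $\mathbb{U}$ are standard Borel spaces (Borel subsets of complete separable metric spaces), with $\mathbb{U}$ compact; $\mathbb{X}\times\mathbb{U}$ carries a product metric $d$. Pointwise weak convergence: $\mathcal{T}_n(\cdot|x,u)\to\mathcal{T}(\cdot|x,u)$ weakly for every $(x,u)\in\mathbb{X}\times\mathbb{U}$. Continuous weak convergence: $\mathcal{T}_n(\cdot|x_n,u_n)\to\mathcal{T}(\cdot|x,u)$ weakly for every sequence $(x_n,u_n)\to(x,u)$ in $\mathbb{X}\times\mathbb{U}$. *)

theory Defs
  imports "HOL-Probability.Probability"
begin

text \<open>
  The spaces are Borel subsets \<open>X\<close>, \<open>U\<close> of Polish types, with the metric and the Borel
  sigma-algebra inherited from the type.  The metric on \<open>X \<times> U\<close> is the library's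
  \<open>dist\<close> on pairs.  The only metric condition used below, \<open>equicontinuous_densities\<close>, lets the
  radius depend on the base point, so it is the same for every metric inducing the product topology.

  Kernels and densities are total functions on the ambient types; only their values at points
  of \<open>X \<times> U\<close>, respectively \<open>X\<close>, are constrained.
\<close>

abbreviation borel_on :: "'a::topological_space set \<Rightarrow> 'a measure" where
  "borel_on X \<equiv> restrict_space borel X"

definition stochastic_kernels ::
  "'a::polish_space set \<Rightarrow> 'b::polish_space set \<Rightarrow> ('a \<times> 'b \<Rightarrow> 'a measure) set" where
  "stochastic_kernels X U = (borel_on X \<Otimes>\<^sub>M borel_on U) \<rightarrow>\<^sub>M prob_algebra (borel_on X)"

text \<open>
  \<open>g\<close> is a density of \<open>\<mu>\<close> with respect to \<open>\<psi>\<close>.  Nonnegativity is stated explicitly because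
  \<open>ennreal\<close> truncates negative values to 0.
\<close>

definition has_density :: "'a measure \<Rightarrow> 'a measure \<Rightarrow> ('a \<Rightarrow> real) \<Rightarrow> bool" where
  "has_density \<mu> \<psi> g \<longleftrightarrow>
     g \<in> borel_measurable \<psi> \<and> (AE y in \<psi>. 0 \<le> g y) \<and> \<mu> = density \<psi> (\<lambda>y. ennreal (g y))"

definition equicontinuous_densities ::
  "'a::polish_space set \<Rightarrow> 'b::polish_space set \<Rightarrow> 'k set \<Rightarrow>
    ('k \<Rightarrow> 'a \<times> 'b \<Rightarrow> 'a \<Rightarrow> real) \<Rightarrow> bool" where
  "equicontinuous_densities X U K f \<longleftrightarrow>
     (\<forall>z\<in>X \<times> U. \<forall>\<epsilon>>0. \<exists>\<delta>>0. \<forall>z'\<in>X \<times> U. dist z z' < \<delta> \<longrightarrow>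
        (\<forall>M\<in>K. \<forall>y\<in>X. \<bar>f M z y - f M z' y\<bar> \<le> \<epsilon>))"

text \<open>
  Weak convergence of measures on \<open>borel_on X\<close>.  (The library's \<open>weak_conv_m\<close> covers measures on
  the real line only.)  Test functions are continuous on the subspace \<open>X\<close>; they need not extend
  continuously to the ambient type.
\<close>

definition weakly_converges_on ::
  "'a::topological_space set \<Rightarrow> (nat \<Rightarrow> 'a measure) \<Rightarrow> 'a measure \<Rightarrow> bool" where
  "weakly_converges_on X \<mu>s \<mu> \<longleftrightarrow>
     (\<forall>g::'a \<Rightarrow> real. continuous_on X g \<and> bounded (g ` X) \<longrightarrow>
        (\<lambda>n. \<integral>y. g y \<partial>\<mu>s n) \<longlonglongrightarrow> (\<integral>y. g y \<partial>\<mu>))"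

definition pointwise_weak_convergence ::
  "'a::polish_space set \<Rightarrow> 'b::polish_space set \<Rightarrow>
    (nat \<Rightarrow> 'a \<times> 'b \<Rightarrow> 'a measure) \<Rightarrow> ('a \<times> 'b \<Rightarrow> 'a measure) \<Rightarrow> bool" where
  "pointwise_weak_convergence X U Tn T \<longleftrightarrow>
     (\<forall>z\<in>X \<times> U. weakly_converges_on X (\<lambda>n. Tn n z) (T z))"

definition continuous_weak_convergence ::
  "'a::polish_space set \<Rightarrow> 'b::polish_space set \<Rightarrow>
    (nat \<Rightarrow> 'a \<times> 'b \<Rightarrow> 'a measure) \<Rightarrow> ('a \<times> 'b \<Rightarrow> 'a measure) \<Rightarrow> bool" where
  "continuous_weak_convergence X U Tn T \<longleftrightarrow>
     (\<forall>zs z. (\<forall>n. zs n \<in> X \<times> U) \<and> z \<in> X \<times> U \<and> zs \<longlonglongrightarrow> z \<longrightarrow>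
        weakly_converges_on X (\<lambda>n. Tn n (zs n)) (T z))"

end

theory Submission
  imports Defs
begin

text \<open>
  For a bounded test function \<open>g\<close> and \<open>z\<^sub>n \<longlonglongrightarrow> z\<close>, the integrals of \<open>g\<close> against \<open>T\<^sub>n z\<^sub>n\<close> and \<open>T\<^sub>n z\<close> differ by at
  most \<open>sup |g|\<close> times the uniform distance of the two densities, since \<open>\<psi>\<close> has mass one.
  By equicontinuity this distance vanishes, uniformly over the kernels, as \<open>z\<^sub>n\<close> approaches \<open>z\<close>, so
  the limit is the one that pointwise convergence gives at the fixed point \<open>z\<close>.
\<close>

lemma has_density_integral_diff_le:
  fixes g :: "'a \<Rightarrow> real"
  assumes "prob_space \<psi>" "finite_measure \<mu>" "finite_measure \<nu>"
    and p: "has_density \<mu> \<psi> p" and q: "has_density \<nu> \<psi> q"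
    and g[measurable]: "g \<in> borel_measurable \<psi>"
    and B: "\<And>y. y \<in> space \<psi> \<Longrightarrow> \<bar>g y\<bar> \<le> B"
    and pq: "\<And>y. y \<in> space \<psi> \<Longrightarrow> \<bar>p y - q y\<bar> \<le> e"
  shows "\<bar>(\<integral>y. g y \<partial>\<mu>) - (\<integral>y. g y \<partial>\<nu>)\<bar> \<le> e * B"
proof -
  interpret prob_space \<psi> by fact
  \<comment> \<open>Both integrals move to the common measure \<open>\<psi>\<close>, where they can
    be subtracted under one integral sign; integrability is carried along because linearity and
    monotonicity of the integral require it.\<close>
  have *: "integrable \<psi> (\<lambda>y. r y * g y) \<and> (\<integral>y. g y \<partial>\<rho>) = (\<integral>y. r y * g y \<partial>\<psi>)"
    if "finite_measure \<rho>" and r: "has_density \<rho> \<psi> r" for \<rho> r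
  proof -
    interpret \<rho>: finite_measure \<rho> by fact
    have [measurable]: "r \<in> borel_measurable \<psi>" and r0: "AE y in \<psi>. 0 \<le> r y"
      and eq: "\<rho> = density \<psi> (\<lambda>y. ennreal (r y))"
      using r by (auto simp: has_density_def)
    \<comment> \<open>A bounded function is integrable for the finite measure \<open>\<rho>\<close>;
      the density formula turns this into integrability of \<open>r * g\<close> under
      \<open>\<psi>\<close>.\<close>
    have "integrable \<rho> g"
      using B by (intro \<rho>.integrable_const_bound[where B = B]) (auto simp: eq)
    then show ?thesis
      using r0 by (simp add: eq integrable_density integral_density)
  qed
  have "(\<integral>y. g y \<partial>\<mu>) - (\<integral>y. g y \<partial>\<nu>) = (\<integral>y. p y * g y - q y * g y \<partial>\<psi>)"
    using *[OF assms(2) p] *[OF assms(3) q] by simp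
  also have "\<bar>\<dots>\<bar> \<le> (\<integral>y. \<bar>p y * g y - q y * g y\<bar> \<partial>\<psi>)"
    by (rule integral_abs_bound)
  also have "\<dots> \<le> (\<integral>y. e * B \<partial>\<psi>)"
  proof (rule integral_mono)
    show "\<bar>p y * g y - q y * g y\<bar> \<le> e * B" if "y \<in> space \<psi>" for y
    proof -
      have "\<bar>p y * g y - q y * g y\<bar> = \<bar>p y - q y\<bar> * \<bar>g y\<bar>"
        by (simp add: abs_mult[symmetric] left_diff_distrib)
      \<comment> \<open>The sign condition \<open>0 \<le> e\<close> comes from \<open>pq\<close> at
        the point \<open>y\<close>.\<close>
      also have "\<dots> \<le> e * B"
        using B[OF that] pq[OF that] by (intro mult_mono) auto
      finally show ?thesis .
    qed
  qed (use *[OF assms(2) p] *[OF assms(3) q] in auto)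
  also have "\<dots> = e * B"
    by (simp add: prob_space)
  finally show ?thesis .
qed

text \<open>A measurable map sends points of its source space to points of its target space, and
  those of \<open>prob_algebra\<close> are probability measures. This supplies the finiteness that
  the integral estimate asks for.\<close>

lemma prob_space_stochastic_kernel:
  assumes "M \<in> stochastic_kernels X U" "z \<in> X \<times> U"
  shows "prob_space (M z)"
proof -
  have "M \<in> (borel_on X \<Otimes>\<^sub>M borel_on U) \<rightarrow>\<^sub>M prob_algebra (borel_on X)"
    using assms(1) by (simp only: stochastic_kernels_def)
  moreover have "z \<in> space (borel_on X \<Otimes>\<^sub>M borel_on U)"
    using assms(2) by (simp add: space_pair_measure space_restrict_space)
  ultimately have "M z \<in> space (prob_algebra (borel_on X))"
    by (rule measurable_space)
  then show ?thesis
    by (simp add: space_prob_algebra)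
qed

theorem proposition2p10:
  fixes X :: "'a::polish_space set" and U :: "'b::polish_space set"
    and K :: "('a \<times> 'b \<Rightarrow> 'a measure) set"
    and \<psi> :: "'a measure"
    and f :: "('a \<times> 'b \<Rightarrow> 'a measure) \<Rightarrow> 'a \<times> 'b \<Rightarrow> 'a \<Rightarrow> real"
    and Tn :: "nat \<Rightarrow> 'a \<times> 'b \<Rightarrow> 'a measure"
    and T :: "'a \<times> 'b \<Rightarrow> 'a measure"
  assumes "X \<in> sets borel" and "U \<in> sets borel" and "compact U"
    and "K \<subseteq> stochastic_kernels X U"
    and "\<psi> \<in> space (prob_algebra (borel_on X))"
    and "\<And>M z. M \<in> K \<Longrightarrow> z \<in> X \<times> U \<Longrightarrow> has_density (M z) \<psi> (f M z)"
    and "equicontinuous_densities X U K f"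
    and "range Tn \<subseteq> K" and "T \<in> K"
    and "pointwise_weak_convergence X U Tn T"
  shows "continuous_weak_convergence X U Tn T"
  unfolding continuous_weak_convergence_def weakly_converges_on_def
proof (intro allI impI, elim conjE)
  fix zs z and g :: "'a \<Rightarrow> real"
  assume zs: "\<forall>n. zs n \<in> X \<times> U" and z: "z \<in> X \<times> U" and lim: "zs \<longlonglongrightarrow> z"
    and g: "continuous_on X g" and "bounded (g ` X)"
  then obtain B where "B > 0" and B: "\<And>y. y \<in> X \<Longrightarrow> \<bar>g y\<bar> \<le> B"
    by (auto simp: bounded_pos)
  have \<psi>: "prob_space \<psi>" and sets: "sets \<psi> = sets (borel_on X)"
    using assms(5) by (auto simp: space_prob_algebra)
  have space: "space \<psi> = X"
    using sets_eq_imp_space_eq[OF sets] by (simp add: space_restrict_space)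
  \<comment> \<open>Continuity on \<open>X\<close> alone suffices, since \<open>\<psi>\<close>
    carries the Borel sigma-algebra of the subspace.\<close>
  have g_meas: "g \<in> borel_measurable \<psi>"
    using borel_measurable_continuous_on_restrict[OF g] measurable_cong_sets[OF sets refl] by blast
  have TnK: "Tn n \<in> K" for n
    using assms(8) by auto
  have fin: "finite_measure (Tn n w)" if "w \<in> X \<times> U" for n w
    using prob_space_stochastic_kernel[of "Tn n" X U w] that TnK assms(4)
    by (auto intro: prob_space.finite_measure)
  have pointwise: "(\<lambda>n. \<integral>y. g y \<partial>Tn n z) \<longlonglongrightarrow> (\<integral>y. g y \<partial>T z)"
    using assms(10) z g \<open>bounded (g ` X)\<close>
    by (auto simp: pointwise_weak_convergence_def weakly_converges_on_def)
  \<comment> \<open>The same kernel \<open>Tn n\<close> is compared at two points, so only the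
    variation of its own density matters.\<close>
  have "(\<lambda>n. (\<integral>y. g y \<partial>Tn n (zs n)) - (\<integral>y. g y \<partial>Tn n z)) \<longlonglongrightarrow> 0"
  proof (rule tendstoI)
    fix \<epsilon> :: real assume "\<epsilon> > 0"
    \<comment> \<open>The factor 2 gives \<open>e * B = \<epsilon> / 2\<close>, hence a strict
      inequality from the non-strict estimate.\<close>
    define e where "e = \<epsilon> / (2 * B)"
    have "e > 0" using \<open>\<epsilon> > 0\<close> \<open>B > 0\<close> by (simp add: e_def)
    \<comment> \<open>Uniformity over \<open>K\<close> is decisive: the radius \<open>d\<close> is
      fixed before \<open>n\<close> and serves every \<open>Tn n\<close>.\<close>
    then obtain d where "d > 0" and d: "\<And>w M y. w \<in> X \<times> U \<Longrightarrow> dist z w < d \<Longrightarrow> M \<in> K \<Longrightarrow> y \<in> X \<Longrightarrow>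
        \<bar>f M z y - f M w y\<bar> \<le> e"
      using assms(7) z unfolding equicontinuous_densities_def by meson
    show "\<forall>\<^sub>F n in sequentially.
        dist ((\<integral>y. g y \<partial>Tn n (zs n)) - (\<integral>y. g y \<partial>Tn n z)) 0 < \<epsilon>"
      using tendstoD[OF lim \<open>d > 0\<close>]
    proof eventually_elim
      case (elim n)
      have zn: "zs n \<in> X \<times> U" using zs by simp
      have "\<bar>(\<integral>y. g y \<partial>Tn n z) - (\<integral>y. g y \<partial>Tn n (zs n))\<bar> \<le> e * B"
        using d[OF zn _ TnK] elim B
        by (intro has_density_integral_diff_le[OF \<psi> fin[OF z] fin[OF zn]
              assms(6)[OF TnK z] assms(6)[OF TnK zn] g_meas])
          (auto simp: space dist_commute)
      also have "\<dots> < \<epsilon>"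
        using \<open>\<epsilon> > 0\<close> \<open>B > 0\<close> by (simp add: e_def)
      finally show ?case
        by (simp add: dist_real_def abs_minus_commute)
    qed
  qed
  from tendsto_add[OF this pointwise]
  show "(\<lambda>n. \<integral>y. g y \<partial>Tn n (zs n)) \<longlonglongrightarrow> (\<integral>y. g y \<partial>T z)"
    by simp
qed

end
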